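(* Let $G = (N, \Sigma, \mathcal{I}, \mathcal{A}, S, \phi)$ be a probabilistic Tree Adjoining Grammar satisfying the standing assumptions listed in the context, and let $\mathcal{M}$ be its stochastic expectation matrix. Consider the following procedure: for $j=0,1,2,\dots$ in turn, compute $\mathcal{M}^{2^j}$ and test whether the sum of the elements of each row of $\mathcal{M}^{2^j}$ is less than one; halt and report "consistent" at the first $j$ for which the test succeeds. Then: (i) if $\rho(\mathcal{M})<1$, the procedure halts; (ii) if $\rho(\mathcal{M})\ge 1$, the procedure does not halt; (iii) whenever the procedure halts, $G$ is consistent, i.e. $\sum_{v\in L(G)}\Pr(v)=1$.
   Context: **Probabilistic TAG.** A probabilistic Tree Adjoining Grammar (TAG) is a tuple $G=(N,\Sigma,\mathcal{I},\mathcal{A},S,\phi)$, where $N$ and $\Sigma$ are finite sets of non-terminal and terminal symbols, $S\in N$ is the start symbol, and $\mathcal{I}$ (initial trees) and $\mathcal{A}$ (auxiliary trees) are finite sets of finite ordered node-labelled trees, called elementary trees. Nodes of distinct elementary trees are regarded as distinct. Internal nodes are labelled by elements of $N$ and leaves by elements of $\Sigma\cup\{\epsilon\}$ ($\epsilon$ the empty string), except that each auxiliary tree has one distinguished leaf, its foot node, labelled by the same non-terminal as its root. **Adjunction.** Adjoining an auxiliary tree $t$ at a node $X$ whose label equals the root label of $t$ means: remove the subtree rooted at $X$, put $t$ in its place, and attach the removed subtree at the foot node of $t$. For a node $X$, $\mathrm{Adj}(X)\subseteq\mathcal{A}$ denotes the set of auxiliary trees that can be adjoined at $X$. Write $X\mapsto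 t$ for the adjunction of $t$ at $X$, and $X\mapsto nil$ for no adjunction at $X$. Let $V=\{X_1,\dots,X_k\}$ be the set of all nodes of all trees in $\mathcal{I}\cup\mathcal{A}$ at which adjunction can occur. The function $\phi$ assigns to each $X\mapsto t$ ($X\in V$, $t\in\mathrm{Adj}(X)\cup\{nil\}$) a probability in $[0,1]$; set $\phi(X\mapsto t)=0$ if $t\in(\mathcal{I}\cup\mathcal{A})\setminus\mathrm{Adj}(X)$. **Standing assumptions on $G$.** 1. $G$ is lexicalized: each elementary tree has at least one leaf labelled by an element of $\Sigma$. 2. $G$ is proper: $\phi(X\mapsto nil)+\sum_{t}\phi(X\mapsto t)=1$ for each $X\in V$. 3. Adjunction is prohibited at the foot node of every auxiliary tree. 4. There is a distinguished non-lexicalized start tree $\tau$ (not counted in $\mathcal{I}\cup\mathcal{A}$ and exempt from assumption 1) into which exactly one initial tree with root labelled $S$ is substituted to start a derivation. The initial tree is chosen according to a probability distribution on the initial trees with root label $S$. **Derivations and string probabilities.** A derivation is generated level by level. Level $0$ consists of the initial tree chosen for $\tau$. For each elementary tree occurring at level $i$ and each node $X\in V$ of that tree, independently of everything else, either an auxiliary tree $t\in\mathrm{Adj}(X)$ is adjoined at $X$, with probability $\phi(X\mapsto t)$, this $t$ then occurring at level $i+1$, or no adjunction takes place at $X$, with probability $\phi(X\mapsto nil)$. A (complete) derivation is one in which this process stops after finitely many levels. Its probability is the product of the probability of the initial choice and of all the $\phi$-values used, including those of the $nil$ choices. A derivation yields the string in $\Sigma^*$ read from the leaves of the resulting derived tree.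 $\Pr(v)$ is the sum of the probabilities of all complete derivations yielding $v$, and $L(G)$ is the set of strings generated by $G$ (with $\Pr(v)=0$ for $v\notin L(G)$). $G$ is consistent if $\sum_{v\in L(G)}\Pr(v)=1$. **Stochastic expectation matrix.** Enumerate $\mathcal{I}\cup\mathcal{A}=\{t_1,\dots,t_m\}$. Let $\mathbf{P}$ be the $k\times m$ matrix with $\mathbf{P}_{ij}=\phi(X_i\mapsto t_j)$, and let $\mathbf{N}$ be the $m\times k$ matrix with $\mathbf{N}_{ij}=1$ if $X_j$ is a node of $t_i$ and $\mathbf{N}_{ij}=0$ otherwise. Then $\mathcal{M}=\mathbf{P}\cdot\mathbf{N}$, a $k\times k$ matrix with non-negative entries; $\rho(\mathcal{M})$ is its spectral radius, the largest modulus of an eigenvalue of $\mathcal{M}$. *)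

theory Defs
  imports
    "HOL-Analysis.Infinite_Sum"
    "HOL-Library.While_Combinator"
    "Jordan_Normal_Form.Spectral_Radius"
begin

section \<open>Trees and adjunction\<close>

text \<open>
  \<open>Leaf None\<close> is a leaf labelled by the empty string. \<open>Open A\<close> is a leaf labelled by a
  non-terminal: the foot node of an auxiliary tree, or the substitution node of the start tree.
\<close>

datatype ('n, 's) tree =
    Node 'n "('n, 's) tree list"
  | Leaf "'s option"
  | Open 'n

text \<open>Nodes of a tree are addressed by paths from the root.\<close>

type_synonym address = "nat list"

fun subtree :: "('n, 's) tree \<Rightarrow> address \<Rightarrow> ('n, 's) tree option" where
  "subtree t [] = Some t"
| "subtree (Node A ts) (i # p) = (if i < length ts then subtree (ts ! i) p else None)"
| "subtree (Leaf a) (i # p) = None"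
| "subtree (Open A) (i # p) = None"

definition addresses :: "('n, 's) tree \<Rightarrow> address set" where
  "addresses t = {p. subtree t p \<noteq> None}"

text \<open>The non-terminal labelling the root; \<open>None\<close> for leaves labelled by a terminal or by the
  empty string.\<close>

fun root_nt :: "('n, 's) tree \<Rightarrow> 'n option" where
  "root_nt (Node A ts) = Some A"
| "root_nt (Leaf a) = None"
| "root_nt (Open A) = Some A"

fun open_leaves :: "('n, 's) tree \<Rightarrow> 'n list" where
  "open_leaves (Node A ts) = concat (map open_leaves ts)"
| "open_leaves (Leaf a) = []"
| "open_leaves (Open A) = [A]"

fun yield :: "('n, 's) tree \<Rightarrow> 's list" where
  "yield (Node A ts) = concat (map yield ts)"
| "yield (Leaf None) = []"
| "yield (Leaf (Some a)) = [a]"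
| "yield (Open A) = []"

fun labels_ok :: "'n set \<Rightarrow> 's set \<Rightarrow> ('n, 's) tree \<Rightarrow> bool" where
  "labels_ok NT TM (Node A ts) \<longleftrightarrow> A \<in> NT \<and> ts \<noteq> [] \<and> (\<forall>t \<in> set ts. labels_ok NT TM t)"
| "labels_ok NT TM (Leaf None) \<longleftrightarrow> True"
| "labels_ok NT TM (Leaf (Some a)) \<longleftrightarrow> a \<in> TM"
| "labels_ok NT TM (Open A) \<longleftrightarrow> A \<in> NT"

text \<open>
  \<open>plug t u\<close> puts \<open>u\<close> at the open leaf of \<open>t\<close>. Adjoining the auxiliary tree \<open>t\<close> at a node replaces
  the subtree \<open>u\<close> rooted at that node by \<open>plug t u\<close>.
\<close>

fun plug :: "('n, 's) tree \<Rightarrow> ('n, 's) tree \<Rightarrow> ('n, 's) tree" where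
  "plug (Node A ts) u = Node A (map (\<lambda>t. plug t u) ts)"
| "plug (Leaf a) u = Leaf a"
| "plug (Open A) u = u"

text \<open>
  \<open>adjoin_all t g\<close> adjoins \<open>g p\<close> at every address \<open>p\<close> of \<open>t\<close> where \<open>g\<close> is defined, below an address
  before the address itself, so that the addresses always refer to the original tree \<open>t\<close>.
\<close>

definition adjoin_root :: "('n, 's) tree option \<Rightarrow> ('n, 's) tree \<Rightarrow> ('n, 's) tree" where
  "adjoin_root c u = (case c of None \<Rightarrow> u | Some t \<Rightarrow> plug t u)"

function adjoin_all ::
  "('n, 's) tree \<Rightarrow> (address \<Rightarrow> ('n, 's) tree option) \<Rightarrow> ('n, 's) tree" where
  "adjoin_all (Node A ts) g = adjoin_root (g [])
     (Node A (map (\<lambda>i. adjoin_all (ts ! i) (\<lambda>p. g (i # p))) [0..<length ts]))"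
| "adjoin_all (Leaf a) g = adjoin_root (g []) (Leaf a)"
| "adjoin_all (Open A) g = adjoin_root (g []) (Open A)"
  by pat_completeness auto
termination
  by (relation "measure (\<lambda>(t, g). size t)") (auto simp: less_Suc_eq_le intro!: size_list_estimation')


section \<open>Probabilistic tree adjoining grammars\<close>

text \<open>
  A node of an elementary tree is a pair of that tree and an address in it, so nodes of distinct
  trees are distinct. In \<open>\<phi>\<close>, the value \<open>None\<close> stands for \<open>nil\<close>. The field \<open>adj\<close> is the map
  \<open>Adj\<close>; it may be any restriction of the label condition, so that adjoining constraints
  are covered. The field \<open>init\<close> is the distribution from which the initial tree substituted into the
  start tree \<open>\<tau>\<close> is chosen.
\<close>

type_synonym ('n, 's) node = "('n, 's) tree \<times> address"

record ('n, 's) ptag =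
  nonterminals :: "'n set"
  terminals :: "'s set"
  initials :: "('n, 's) tree set"
  auxiliaries :: "('n, 's) tree set"
  start :: "'n"
  phi :: "('n, 's) node \<Rightarrow> ('n, 's) tree option \<Rightarrow> real"
  adj :: "('n, 's) node \<Rightarrow> ('n, 's) tree set"
  start_tree :: "('n, 's) tree"
  init :: "('n, 's) tree \<Rightarrow> real"

definition elementary :: "('n, 's) ptag \<Rightarrow> ('n, 's) tree set" where
  "elementary G = initials G \<union> auxiliaries G"

text \<open>The set \<open>V\<close> of nodes at which adjunction can occur, and its part belonging to one tree.\<close>

definition adj_nodes :: "('n, 's) ptag \<Rightarrow> ('n, 's) node set" where
  "adj_nodes G = {(t, p). t \<in> elementary G \<and> p \<in> addresses t \<and> adj G (t, p) \<noteq> {}}"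

definition sites :: "('n, 's) ptag \<Rightarrow> ('n, 's) tree \<Rightarrow> address set" where
  "sites G t = {p. (t, p) \<in> adj_nodes G}"

definition start_initials :: "('n, 's) ptag \<Rightarrow> ('n, 's) tree set" where
  "start_initials G = {t \<in> initials G. root_nt t = Some (start G)}"

definition is_ptag :: "('n, 's) ptag \<Rightarrow> bool" where
  "is_ptag G \<longleftrightarrow>
     finite (nonterminals G) \<and> finite (terminals G) \<and> start G \<in> nonterminals G \<and>
     finite (initials G) \<and> finite (auxiliaries G) \<and>
     (\<forall>t \<in> elementary G. labels_ok (nonterminals G) (terminals G) t) \<and>
     (\<forall>t \<in> initials G. open_leaves t = []) \<and>
     (\<forall>t \<in> auxiliaries G. \<exists>A ts. t = Node A ts \<and> open_leaves t = [A]) \<and>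
     (\<forall>t \<in> elementary G. \<forall>p u. subtree t p = Some u \<longrightarrow>
        adj G (t, p) \<subseteq> {t' \<in> auxiliaries G. root_nt t' = root_nt u}) \<and>
     (\<forall>X \<in> adj_nodes G. phi G X None \<in> {0..1} \<and> (\<forall>t \<in> adj G X. phi G X (Some t) \<in> {0..1}) \<and>
        (\<forall>t \<in> elementary G - adj G X. phi G X (Some t) = 0))"

definition lexicalized :: "('n, 's) ptag \<Rightarrow> bool" where
  "lexicalized G \<longleftrightarrow> (\<forall>t \<in> elementary G. \<exists>p a. subtree t p = Some (Leaf (Some a)))"

definition proper :: "('n, 's) ptag \<Rightarrow> bool" where
  "proper G \<longleftrightarrow>
     (\<forall>X \<in> adj_nodes G. phi G X None + (\<Sum>t \<in> auxiliaries G. phi G X (Some t)) = 1)"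

definition no_foot_adjunction :: "('n, 's) ptag \<Rightarrow> bool" where
  "no_foot_adjunction G \<longleftrightarrow>
     (\<forall>t \<in> auxiliaries G. \<forall>p A. subtree t p = Some (Open A) \<longrightarrow> adj G (t, p) = {})"

definition start_ok :: "('n, 's) ptag \<Rightarrow> bool" where
  "start_ok G \<longleftrightarrow>
     labels_ok (nonterminals G) (terminals G) (start_tree G) \<and>
     open_leaves (start_tree G) = [start G] \<and>
     \<not> (\<exists>p a. subtree (start_tree G) p = Some (Leaf (Some a))) \<and>
     (\<forall>t \<in> start_initials G. 0 \<le> init G t) \<and> (\<Sum>t \<in> start_initials G. init G t) = 1"


section \<open>Derivations, string probabilities and consistency\<close>

text \<open>
  \<open>Deriv t f\<close> records an occurrence of the elementary tree \<open>t\<close> and, for each address \<open>p\<close> of \<open>t\<close>,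
  either no adjunction (\<open>f p = None\<close>) or the derivation \<open>f p\<close> of the tree adjoined there. Being
  elements of a datatype, derivations have no infinite branches; as elementary trees are finite,
  this means that they have finitely many levels.
\<close>

datatype ('n, 's) deriv =
  Deriv (deriv_root: "('n, 's) tree") "address \<Rightarrow> ('n, 's) deriv option"

inductive valid_deriv :: "('n, 's) ptag \<Rightarrow> ('n, 's) deriv \<Rightarrow> bool" for G where
  "t \<in> elementary G \<Longrightarrow>
   (\<And>p d. f p = Some d \<Longrightarrow>
      p \<in> sites G t \<and> deriv_root d \<in> adj G (t, p) \<and> valid_deriv G d) \<Longrightarrow>
   valid_deriv G (Deriv t f)"

text \<open>The product of all values of \<open>\<phi>\<close> used in a derivation.\<close>

primrec phi_product :: "('n, 's) ptag \<Rightarrow> ('n, 's) deriv \<Rightarrow> real" where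
  "phi_product G (Deriv t f) =
     (\<Prod>p \<in> sites G t.
        case map_option (\<lambda>d. (deriv_root d, phi_product G d)) (f p) of
          None \<Rightarrow> phi G (t, p) None
        | Some (t', q) \<Rightarrow> phi G (t, p) (Some t') * q)"

primrec derived_tree :: "('n, 's) deriv \<Rightarrow> ('n, 's) tree" where
  "derived_tree (Deriv t f) = adjoin_all t (\<lambda>p. map_option derived_tree (f p))"

definition complete_derivs :: "('n, 's) ptag \<Rightarrow> ('n, 's) deriv set" where
  "complete_derivs G = {d. valid_deriv G d \<and> deriv_root d \<in> start_initials G}"

definition deriv_prob :: "('n, 's) ptag \<Rightarrow> ('n, 's) deriv \<Rightarrow> real" where
  "deriv_prob G d = init G (deriv_root d) * phi_product G d"

definition deriv_yield :: "('n, 's) ptag \<Rightarrow> ('n, 's) deriv \<Rightarrow> 's list" where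
  "deriv_yield G d = yield (plug (start_tree G) (derived_tree d))"

definition lang :: "('n, 's) ptag \<Rightarrow> 's list set" where
  "lang G = deriv_yield G ` complete_derivs G"

definition string_prob :: "('n, 's) ptag \<Rightarrow> 's list \<Rightarrow> real" where
  "string_prob G v = (\<Sum>\<^sub>\<infinity>d \<in> {d \<in> complete_derivs G. deriv_yield G d = v}. deriv_prob G d)"

text \<open>\<open>infsum\<close> is 0 for families that are not summable, so the value 1 includes summability.\<close>

definition consistent :: "('n, 's) ptag \<Rightarrow> bool" where
  "consistent G \<longleftrightarrow> (\<Sum>\<^sub>\<infinity>v \<in> lang G. string_prob G v) = 1"


section \<open>The stochastic expectation matrix and the procedure\<close>

text \<open>The matrices are relative to enumerations \<open>Xs\<close> of \<open>V\<close> and \<open>ts\<close> of the elementary trees.\<close>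

definition P_mat ::
  "('n, 's) ptag \<Rightarrow> ('n, 's) node list \<Rightarrow> ('n, 's) tree list \<Rightarrow> real mat" where
  "P_mat G Xs ts = mat (length Xs) (length ts) (\<lambda>(i, j). phi G (Xs ! i) (Some (ts ! j)))"

definition N_mat :: "('n, 's) node list \<Rightarrow> ('n, 's) tree list \<Rightarrow> real mat" where
  "N_mat Xs ts = mat (length ts) (length Xs) (\<lambda>(i, j). if fst (Xs ! j) = ts ! i then 1 else 0)"

definition expectation_mat ::
  "('n, 's) ptag \<Rightarrow> ('n, 's) node list \<Rightarrow> ('n, 's) tree list \<Rightarrow> real mat" where
  "expectation_mat G Xs ts = P_mat G Xs ts * N_mat Xs ts"

text \<open>The library's \<open>spectral_radius\<close> is \<open>Max {}\<close> for the empty matrix (no node allows adjunction);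
  there we use the convention that the spectral radius is 0.\<close>

definition rho :: "real mat \<Rightarrow> real" where
  "rho A = (if dim_row A = 0 then 0 else spectral_radius (map_mat complex_of_real A))"

definition row_sums_less_one :: "real mat \<Rightarrow> bool" where
  "row_sums_less_one A \<longleftrightarrow> (\<forall>i < dim_row A. (\<Sum>j < dim_col A. A $$ (i, j)) < 1)"

text \<open>The result is \<open>Some j\<close> if the procedure halts at \<open>j\<close>, and \<open>None\<close> if it does not halt.\<close>

definition procedure :: "real mat \<Rightarrow> nat option" where
  "procedure M = while_option (\<lambda>j. \<not> row_sums_less_one (M ^\<^sub>m (2 ^ j))) Suc 0"

definition halts :: "real mat \<Rightarrow> bool" where
  "halts M \<longleftrightarrow> procedure M \<noteq> None"

end

theory Submission
  imports Defs "HOL-Analysis.Infinite_Products"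
begin

text \<open>
  Since \<open>M\<close> is non-negative, some power of it has all row sums below one iff its spectral radius is
  below one: if \<open>\<rho>(M) < r < 1\<close>, the powers of \<open>M / r\<close> are bounded (Jordan normal form), so
  \<open>M\<^sup>k\<close> decays like \<open>r\<^sup>k\<close>; conversely, if the row sums of \<open>M\<^sup>k\<close> are below one, looking at a
  maximal entry of an eigenvector gives \<open>|\<lambda>|\<^sup>k < 1\<close> for each eigenvalue \<open>\<lambda>\<close>.

  For consistency, let \<open>x\<^sub>n(X)\<close> be the probability that a tree is adjoined at \<open>X\<close> whose derivation
  does not stop within \<open>n\<close> levels. The union bound, in the form \<open>1 - (\<Prod>(1 - x)) \<le> \<Sum>x\<close>, gives
  \<open>x\<^bsub>n+1\<^esub> \<le> M x\<^sub>n\<close> componentwise, hence \<open>x\<^bsub>n+k\<^esub> \<le> M\<^sup>k x\<^sub>n\<close>. If the row sums of \<open>M\<^sup>k\<close> are at most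
  \<open>c < 1\<close>, then \<open>x\<^bsub>ak\<^esub> \<le> c\<^sup>a \<rightarrow> 0\<close>, so complete derivations have total probability one; it remains
  to group them by their yields.
\<close>

section \<open>Powers of non-negative matrices and the spectral radius\<close>

unbundle no vec_syntax

lemma pow_mat_Suc_entry:
  fixes A :: "'a::semiring_1 mat"
  assumes "A \<in> carrier_mat n n" "i < n" "l < n"
  shows "(A ^\<^sub>m Suc k) $$ (i, l) = (\<Sum>j<n. (A ^\<^sub>m k) $$ (i, j) * A $$ (j, l))"
proof -
  have "A ^\<^sub>m k \<in> carrier_mat n n"
    using assms(1) by (rule pow_carrier_mat)
  then show ?thesis
    using assms by (simp add: scalar_prod_def lessThan_atLeast0)
qed

lemma pow_mat_nonneg:
  fixes A :: "real mat"
  assumes A: "A \<in> carrier_mat n n"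
    and nonneg: "\<And>i j. i < n \<Longrightarrow> j < n \<Longrightarrow> 0 \<le> A $$ (i, j)"
    and "i < n" "j < n"
  shows "0 \<le> (A ^\<^sub>m k) $$ (i, j)"
  using assms(3,4)
proof (induction k arbitrary: j)
  case 0
  then show ?case using A by simp
next
  case (Suc k)
  then show ?case
    unfolding pow_mat_Suc_entry[OF A Suc.prems]
    by (intro sum_nonneg mult_nonneg_nonneg) (auto intro: nonneg)
qed

lemma pow_smult_mat:
  fixes A :: "'a::comm_semiring_1 mat"
  assumes A: "A \<in> carrier_mat n n"
  shows "(c \<cdot>\<^sub>m A) ^\<^sub>m k = c ^ k \<cdot>\<^sub>m (A ^\<^sub>m k)"
proof (induction k)
  case 0
  then show ?case using A by (intro eq_matI) auto
next
  case (Suc k)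
  have Ak: "A ^\<^sub>m k \<in> carrier_mat n n"
    using A by (rule pow_carrier_mat)
  have "(c \<cdot>\<^sub>m A) ^\<^sub>m Suc k = (c ^ k \<cdot>\<^sub>m (A ^\<^sub>m k)) * (c \<cdot>\<^sub>m A)"
    by (simp add: Suc)
  also have "\<dots> = c ^ Suc k \<cdot>\<^sub>m (A ^\<^sub>m k * A)"
    using A Ak by (intro eq_matI)
      (auto simp: scalar_prod_def sum_distrib_left mult_ac intro!: sum.cong)
  finally show ?case by simp
qed

text \<open>Pulls eigenvalues of a scaled matrix back to the original one, so that the spectral
  radius of A controls the spectrum after scaling.\<close>

lemma eigenvalue_smult_matD:
  fixes A :: "'a::field mat"
  assumes A: "A \<in> carrier_mat n n" and c: "c \<noteq> 0" and ev: "eigenvalue (c \<cdot>\<^sub>m A) e"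
  shows "eigenvalue A (e / c)"
proof -
  from ev obtain v where v: "v \<in> carrier_vec n" "v \<noteq> 0\<^sub>v n"
    and eq: "(c \<cdot>\<^sub>m A) *\<^sub>v v = e \<cdot>\<^sub>v v"
    using A by (auto simp: eigenvalue_def eigenvector_def)
  have "A *\<^sub>v v = (e / c) \<cdot>\<^sub>v v"
  proof (rule eq_vecI)
    fix i assume "i < dim_vec ((e / c) \<cdot>\<^sub>v v)"
    then have i: "i < n" using v by simp
    have "c * (A *\<^sub>v v) $ i = ((c \<cdot>\<^sub>m A) *\<^sub>v v) $ i"
      using A v i by (simp add: scalar_prod_def sum_distrib_left mult_ac)
    also have "\<dots> = e * v $ i"
      using v i by (simp add: eq)
    finally show "(A *\<^sub>v v) $ i = ((e / c) \<cdot>\<^sub>v v) $ i"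
      using c v i by (simp add: field_simps)
  qed (use A v in auto)
  then show ?thesis
    using A v by (auto simp: eigenvalue_def eigenvector_def)
qed

lemma pow_mat_geometric_bound:
  fixes A :: "complex mat"
  assumes A: "A \<in> carrier_mat n n" and n: "0 < n" and r: "spectral_radius A < r" "0 < r"
  obtains c where "\<And>k i j. i < n \<Longrightarrow> j < n \<Longrightarrow> norm ((A ^\<^sub>m k) $$ (i, j)) \<le> c * r ^ k"
proof -
  \<comment> \<open>Scaling by 1/r moves all eigenvalues into the open unit disc, so the powers of
    \<open>B\<close> stay bounded; undoing the scaling costs the factor r^k.\<close>
  define s where "s = complex_of_real (inverse r)"
  define B where "B = s \<cdot>\<^sub>m A"
  have B: "B \<in> carrier_mat n n" and s: "s \<noteq> 0"
    using A r by (auto simp: B_def s_def)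
  have "norm e < 1" if "e \<in> spectrum B" for e
  proof -
    have "eigenvalue A (e / s)"
      using that eigenvalue_smult_matD[OF A s] by (simp add: spectrum_def B_def)
    then have "norm (e / s) \<le> spectral_radius A"
      using spectral_radius_mem_max(2)[OF A n] by (auto simp: spectrum_def)
    then have "norm (e / s) < r" using r by simp
    then show ?thesis
      using r by (simp add: s_def norm_divide norm_mult field_simps)
  qed
  then have "spectral_radius B < 1"
    using spectral_radius_mem_max(1)[OF B n] by auto
  then obtain c where c: "\<And>k. norm_bound (B ^\<^sub>m k) c"
    using spectral_radius_jnf_norm_bound_less_1_upper_triangular[OF B] by blast
  show thesis
  proof (rule that)
    fix k i j assume ij: "i < n" "j < n"
    have Ak: "A ^\<^sub>m k \<in> carrier_mat n n" using A by (rule pow_carrier_mat)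
    have "norm (((s ^ k) \<cdot>\<^sub>m (A ^\<^sub>m k)) $$ (i, j)) \<le> c"
      using c[of k] ij A Ak by (simp add: B_def pow_smult_mat[OF A] norm_bound_def)
    then have "inverse r ^ k * norm ((A ^\<^sub>m k) $$ (i, j)) \<le> c"
      using ij A Ak r by (simp add: s_def norm_mult norm_power norm_inverse)
    then show "norm ((A ^\<^sub>m k) $$ (i, j)) \<le> c * r ^ k"
      using r by (simp add: field_simps)
  qed
qed

lemma halts_iff: "halts M \<longleftrightarrow> (\<exists>j. row_sums_less_one (M ^\<^sub>m (2 ^ j)))"
proof -
  \<comment> \<open>After k iterations the loop state is k itself, so the iteration count and the
    index of the tested power coincide.\<close>
  have "(Suc ^^ k) 0 = k" for k by (induction k) auto
  then show ?thesis
    unfolding halts_def procedure_def while_option_def by auto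
qed

lemma halts_if_rho_less_one:
  assumes A: "A \<in> carrier_mat n n" and rho: "rho A < 1"
  shows "halts A"
proof (cases "n = 0")
  \<comment> \<open>The test holds vacuously for a matrix without rows. The case is split off
    because a largest eigenvalue modulus exists only in positive dimension.\<close>
  case True
  then have "row_sums_less_one (A ^\<^sub>m 2 ^ 0)"
    using A by (simp add: row_sums_less_one_def)
  then show ?thesis by (auto simp only: halts_iff)
next
  case False
  let ?C = "map_mat complex_of_real A"
  have C: "?C \<in> carrier_mat n n" using A by simp
  have "spectral_radius ?C \<in> norm ` spectrum ?C"
    using spectral_radius_mem_max(1)[OF C] False by simp
  then have "0 \<le> spectral_radius ?C" by auto
  \<comment> \<open>Halfway between the spectral radius and 1; non-negativity of the radius makes r
    positive.\<close>
  define r where "r = (spectral_radius ?C + 1) / 2"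
  have r: "spectral_radius ?C < r" "0 < r" "r < 1"
    using rho False A \<open>0 \<le> spectral_radius ?C\<close> by (auto simp: rho_def r_def)
  obtain c where c: "\<And>k i j. i < n \<Longrightarrow> j < n \<Longrightarrow> norm ((?C ^\<^sub>m k) $$ (i, j)) \<le> c * r ^ k"
    using pow_mat_geometric_bound[OF C _ r(1,2)] False by auto
  have "(\<lambda>k. real n * (c * r ^ k)) \<longlonglongrightarrow> real n * (c * 0)"
    by (intro tendsto_intros LIMSEQ_power_zero) (use r in auto)
  then have "\<forall>\<^sub>F k in sequentially. real n * (c * r ^ k) < 1"
    by (rule order_tendstoD) simp
  then obtain N where N: "\<And>k. k \<ge> N \<Longrightarrow> real n * (c * r ^ k) < 1"
    by (auto simp: eventually_sequentially)
  \<comment> \<open>The procedure inspects only powers whose exponent is a power of two; since N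
    \<le> 2^N, this exponent lies beyond the threshold.\<close>
  define K :: nat where "K = 2 ^ N"
  have "N \<le> K" by (simp add: K_def less_imp_le)
  have AK: "A ^\<^sub>m K \<in> carrier_mat n n" using A by (rule pow_carrier_mat)
  have "row_sums_less_one (A ^\<^sub>m K)"
    unfolding row_sums_less_one_def
  proof (intro allI impI)
    fix i assume "i < dim_row (A ^\<^sub>m K)"
    then have i: "i < n" using A by simp
    have "(A ^\<^sub>m K) $$ (i, j) \<le> c * r ^ K" if "j < n" for j
    proof -
      have "(?C ^\<^sub>m K) $$ (i, j) = complex_of_real ((A ^\<^sub>m K) $$ (i, j))"
        using A AK i that by (simp flip: of_real_hom.mat_hom_pow[OF A])
      with c[OF i that, of K] show ?thesis by simp
    qed
    then have "(\<Sum>j<n. (A ^\<^sub>m K) $$ (i, j)) \<le> real n * (c * r ^ K)"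
      using sum_bounded_above[of "{..<n}" "\<lambda>j. (A ^\<^sub>m K) $$ (i, j)"] by simp
    also have "\<dots> < 1" using N[OF \<open>N \<le> K\<close>] .
    finally show "(\<Sum>j<dim_col (A ^\<^sub>m K). (A ^\<^sub>m K) $$ (i, j)) < 1"
      using carrier_matD[OF AK] by (simp del: pow_mat_dim)
  qed
  then show ?thesis by (auto simp: halts_iff K_def)
qed

lemma rho_less_one_if_halts:
  assumes A: "A \<in> carrier_mat n n"
    and nonneg: "\<And>i j. i < n \<Longrightarrow> j < n \<Longrightarrow> 0 \<le> A $$ (i, j)"
    and halts: "halts A"
  shows "rho A < 1"
proof (cases "n = 0")
  case True
  then show ?thesis using A by (simp add: rho_def)
next
  case False
  let ?C = "map_mat complex_of_real A"
  have C: "?C \<in> carrier_mat n n" using A by simp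
  from halts obtain K where rs: "row_sums_less_one (A ^\<^sub>m K)"
    by (auto simp: halts_iff)
  have AK: "A ^\<^sub>m K \<in> carrier_mat n n" using A by (rule pow_carrier_mat)
  have "norm e < 1" if "e \<in> spectrum ?C" for e
  proof -
    from that obtain v where ev: "eigenvector ?C v e"
      by (auto simp: spectrum_def eigenvalue_def)
    then have v: "v \<in> carrier_vec n" "v \<noteq> 0\<^sub>v n"
      using A by (auto simp: eigenvector_def)
    \<comment> \<open>A component of v of largest modulus. In row m of the K-th power applied to v,
      every |v_j| can be replaced by |v_m|, which turns the product into a row sum.\<close>
    obtain m where m: "m < n" "\<And>j. j < n \<Longrightarrow> norm (v $ j) \<le> norm (v $ m)"
    proof -
      have "finite ((\<lambda>j. norm (v $ j)) ` {..<n})" "(\<lambda>j. norm (v $ j)) ` {..<n} \<noteq> {}"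
        using False by auto
      from Max_in[OF this] Max_ge[OF this(1)] that show thesis by force
    qed
    have pos: "norm (v $ m) > 0"
    proof (rule ccontr)
      assume "\<not> norm (v $ m) > 0"
      then have "v $ j = 0" if "j < n" for j
        using m(2)[OF that] by simp
      then have "v = 0\<^sub>v n" using v(1) by (intro eq_vecI) auto
      with v(2) show False by simp
    qed
    have "e ^ K * v $ m = (?C ^\<^sub>m K *\<^sub>v v) $ m"
      using v m by (simp add: eigenvector_pow[OF C ev])
    also have "\<dots> = (\<Sum>j<n. complex_of_real ((A ^\<^sub>m K) $$ (m, j)) * v $ j)"
      using A AK v m
      by (simp add: scalar_prod_def lessThan_atLeast0 flip: of_real_hom.mat_hom_pow[OF A])
    finally have "norm e ^ K * norm (v $ m) =
        norm (\<Sum>j<n. complex_of_real ((A ^\<^sub>m K) $$ (m, j)) * v $ j)"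
      by (metis norm_mult norm_power)
    also have "\<dots> \<le> (\<Sum>j<n. (A ^\<^sub>m K) $$ (m, j) * norm (v $ m))"
    proof (rule sum_norm_le)
      fix j assume "j \<in> {..<n}"
      then show "norm (complex_of_real ((A ^\<^sub>m K) $$ (m, j)) * v $ j)
          \<le> (A ^\<^sub>m K) $$ (m, j) * norm (v $ m)"
        using pow_mat_nonneg[OF A nonneg m(1), of j K] m(2)[of j]
        by (auto simp: norm_mult intro!: mult_left_mono)
    qed
    also have "\<dots> = (\<Sum>j<n. (A ^\<^sub>m K) $$ (m, j)) * norm (v $ m)"
      by (simp add: sum_distrib_right)
    also have "\<dots> < 1 * norm (v $ m)"
      using rs carrier_matD[OF AK] m(1) pos
      by (intro mult_strict_right_mono) (auto simp: row_sums_less_one_def simp del: pow_mat_dim)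
    finally have "norm e ^ K < 1" using pos by simp
    then show ?thesis
      by (meson not_less one_le_power)
  qed
  then have "spectral_radius ?C < 1"
    using spectral_radius_mem_max(1)[OF C] False by auto
  then show ?thesis using A False by (simp add: rho_def)
qed

section \<open>Iterating a linear inequality with a non-negative matrix\<close>

lemma iterated_upper_bound_pow_mat:
  fixes A :: "real mat" and x :: "nat \<Rightarrow> nat \<Rightarrow> real"
  assumes A: "A \<in> carrier_mat n n"
    and nonneg: "\<And>i j. i < n \<Longrightarrow> j < n \<Longrightarrow> 0 \<le> A $$ (i, j)"
    and step: "\<And>m i. i < n \<Longrightarrow> x (Suc m) i \<le> (\<Sum>j<n. A $$ (i, j) * x m j)"
    and "i < n"
  shows "x (m + k) i \<le> (\<Sum>j<n. (A ^\<^sub>m k) $$ (i, j) * x m j)"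
proof (induction k arbitrary: m)
  case 0
  have "(\<Sum>j<n. (A ^\<^sub>m 0) $$ (i, j) * x m j) = (\<Sum>j<n. if i = j then x m j else 0)"
    using A \<open>i < n\<close> by (intro sum.cong) auto
  then show ?case using \<open>i < n\<close> by simp
next
  case (Suc k)
  \<comment> \<open>The first of the Suc k steps leads from m to Suc m, so the induction hypothesis
    is used at Suc m. Non-negative powers then allow the one-step bound to be inserted under the
    sum.\<close>
  have "x (m + Suc k) i \<le> (\<Sum>j<n. (A ^\<^sub>m k) $$ (i, j) * x (Suc m) j)"
    using Suc[of "Suc m"] by simp
  also have "\<dots> \<le> (\<Sum>j<n. (A ^\<^sub>m k) $$ (i, j) * (\<Sum>l<n. A $$ (j, l) * x m l))"
    by (intro sum_mono mult_left_mono step pow_mat_nonneg[OF A nonneg]) (use \<open>i < n\<close> in auto)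
  also have "\<dots> = (\<Sum>l<n. \<Sum>j<n. (A ^\<^sub>m k) $$ (i, j) * A $$ (j, l) * x m l)"
    unfolding sum_distrib_left by (subst sum.swap) (simp add: mult_ac)
  also have "\<dots> = (\<Sum>l<n. (A ^\<^sub>m Suc k) $$ (i, l) * x m l)"
    using \<open>i < n\<close> by (intro sum.cong) (auto simp only: pow_mat_Suc_entry[OF A] sum_distrib_right lessThan_iff)
  finally show ?case .
qed

text \<open>With c the largest row sum of the k-th power, each block of k steps shrinks the bound by
  the factor c < 1. This controls x only at multiples of k; monotonicity in m covers the indices in
  between.\<close>

lemma iterates_tendsto_zero:
  fixes A :: "real mat" and x :: "nat \<Rightarrow> nat \<Rightarrow> real"
  assumes A: "A \<in> carrier_mat n n"
    and nonneg: "\<And>i j. i < n \<Longrightarrow> j < n \<Longrightarrow> 0 \<le> A $$ (i, j)"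
    and rs: "row_sums_less_one (A ^\<^sub>m k)"
    and x_nonneg: "\<And>m i. i < n \<Longrightarrow> 0 \<le> x m i"
    and x_le: "\<And>m i. i < n \<Longrightarrow> x m i \<le> 1"
    and step: "\<And>m i. i < n \<Longrightarrow> x (Suc m) i \<le> (\<Sum>j<n. A $$ (i, j) * x m j)"
    and decr: "\<And>i. i < n \<Longrightarrow> decseq (\<lambda>m. x m i)"
    and i: "i < n"
  shows "(\<lambda>m. x m i) \<longlonglongrightarrow> 0"
proof -
  have Ak: "A ^\<^sub>m k \<in> carrier_mat n n" using A by (rule pow_carrier_mat)
  define R where "R i = (\<Sum>j<n. (A ^\<^sub>m k) $$ (i, j))" for i
  define c where "c = Max (R ` {..<n})"
  have R: "R i \<le> c" if "i < n" for i
    using that by (auto simp: c_def)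
  have "c \<in> R ` {..<n}" using i unfolding c_def by (intro Max_in) auto
  then have "c < 1"
    using rs carrier_matD[OF Ak] by (auto simp: row_sums_less_one_def R_def simp del: pow_mat_dim)
  have "0 \<le> R i"
    unfolding R_def by (intro sum_nonneg pow_mat_nonneg[OF A nonneg i]) auto
  then have "0 \<le> c" using R[OF i] by simp
  have bound: "x (a * k) i \<le> c ^ a" if "i < n" for a i
    using that
  proof (induction a arbitrary: i)
    case 0
    then show ?case using x_le[of i 0] by simp
  next
    case (Suc a)
    have "x (Suc a * k) i \<le> (\<Sum>j<n. (A ^\<^sub>m k) $$ (i, j) * x (a * k) j)"
      using iterated_upper_bound_pow_mat[of A n x i "a * k" k] A nonneg step Suc.prems
      by (simp add: add.commute)
    also have "\<dots> \<le> (\<Sum>j<n. (A ^\<^sub>m k) $$ (i, j) * c ^ a)"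
      by (intro sum_mono mult_left_mono Suc.IH pow_mat_nonneg[OF A nonneg Suc.prems]) auto
    also have "\<dots> = R i * c ^ a" by (simp add: R_def sum_distrib_right)
    also have "\<dots> \<le> c * c ^ a"
      using R[OF Suc.prems] \<open>0 \<le> c\<close> by (intro mult_right_mono) auto
    finally show ?case by simp
  qed
  show ?thesis
  proof (rule LIMSEQ_I)
    fix e :: real assume "0 < e"
    then obtain a where a: "c ^ a < e"
      using real_arch_pow_inv[OF _ \<open>c < 1\<close>] by blast
    have "norm (x m i - 0) < e" if "a * k \<le> m" for m
    proof -
      have "x m i \<le> x (a * k) i" using decr[OF i] that by (auto simp: decseq_def)
      also have "\<dots> < e" using bound[OF i, of a] a by simp
      finally show ?thesis using x_nonneg[OF i, of m] by simp
    qed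
    then show "\<exists>m0. \<forall>m\<ge>m0. norm (x m i - 0) < e" by blast
  qed
qed

section \<open>Derivations of bounded depth\<close>

lemma finite_addresses: "finite (addresses t)"
proof (induction t)
  case (Node A ts)
  have "addresses (Node A ts) \<subseteq> insert [] (\<Union>i<length ts. (#) i ` addresses (ts ! i))"
  proof
    fix p assume "p \<in> addresses (Node A ts)"
    then show "p \<in> insert [] (\<Union>i<length ts. (#) i ` addresses (ts ! i))"
      by (cases p) (auto simp: addresses_def split: if_splits)
  qed
  moreover have "finite (addresses (ts ! i))" if "i < length ts" for i
    using Node that by auto
  ultimately show ?case by (auto intro: finite_subset)
next
  case (Leaf a)
  have "addresses (Leaf a :: ('a, 'b) tree) \<subseteq> {[]}"
  proof
    fix p assume "p \<in> addresses (Leaf a :: ('a, 'b) tree)"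
    then show "p \<in> {[]}" by (cases p) (auto simp: addresses_def)
  qed
  then show ?case by (rule finite_subset) simp
next
  case (Open A)
  have "addresses (Open A :: ('a, 'b) tree) \<subseteq> {[]}"
  proof
    fix p assume "p \<in> addresses (Open A :: ('a, 'b) tree)"
    then show "p \<in> {[]}" by (cases p) (auto simp: addresses_def)
  qed
  then show ?case by (rule finite_subset) simp
qed

lemma finite_sites: "finite (sites G t)"
  by (rule finite_subset[OF _ finite_addresses[of t]]) (auto simp: sites_def adj_nodes_def)

lemma adj_nodes_eq_Sigma: "adj_nodes G = Sigma (elementary G) (sites G)"
  by (auto simp: sites_def adj_nodes_def)

text \<open>Removes the pairing under \<open>map_option\<close>, which only serves the nested
  primitive recursion.\<close>

lemma phi_product_Deriv:
  "phi_product G (Deriv t f) = (\<Prod>p \<in> sites G t.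
     case f p of None \<Rightarrow> phi G (t, p) None
     | Some d \<Rightarrow> phi G (t, p) (Some (deriv_root d)) * phi_product G d)"
  by (auto intro!: prod.cong split: option.split)

text \<open>\<open>derivs_upto G n t\<close> consists of the derivations from \<open>t\<close> with at most \<open>n\<close> levels, the level
  of \<open>t\<close> included; so there are none for \<open>n = 0\<close>.\<close>

fun derivs_upto :: "('n, 's) ptag \<Rightarrow> nat \<Rightarrow> ('n, 's) tree \<Rightarrow> ('n, 's) deriv set" where
  "derivs_upto G 0 t = {}"
| "derivs_upto G (Suc n) t =
     (\<lambda>g. Deriv t (\<lambda>p. if p \<in> sites G t then g p else None)) `
     (\<Pi>\<^sub>E p\<in>sites G t. insert None (Some ` (\<Union>u\<in>adj G (t, p). derivs_upto G n u)))"

text \<open>The extensional function space in \<open>derivs_upto\<close> leaves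
  \<open>undefined\<close> outside the sites, which the \<open>if\<close> there turns into
  \<open>None\<close>. This form hides the encoding and serves arguments about single
  derivations.\<close>

lemma mem_derivs_upto_Suc:
  "Deriv t f \<in> derivs_upto G (Suc n) t' \<longleftrightarrow> t = t' \<and>
     (\<forall>p d. f p = Some d \<longrightarrow> p \<in> sites G t \<and> (\<exists>u\<in>adj G (t, p). d \<in> derivs_upto G n u))"
  (is "?L \<longleftrightarrow> ?R")
proof
  assume ?L
  then obtain g where t: "t = t'" and f: "f = (\<lambda>p. if p \<in> sites G t' then g p else None)"
    and g: "\<And>p. p \<in> sites G t' \<Longrightarrow> g p \<in> insert None (Some ` (\<Union>u\<in>adj G (t', p). derivs_upto G n u))"
    by (auto simp: PiE_iff)
  have "p \<in> sites G t' \<and> (\<exists>u\<in>adj G (t', p). d \<in> derivs_upto G n u)" if "f p = Some d" for p d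
  proof -
    have p: "p \<in> sites G t'" "g p = Some d" using that by (auto simp: f split: if_splits)
    then show ?thesis using g[OF p(1)] by auto
  qed
  then show ?R using t by blast
next
  assume R: ?R
  \<comment> \<open>Outside the sites f is \<open>None\<close> by assumption, so restricting it to
    the sites loses nothing.\<close>
  let ?g = "restrict f (sites G t)"
  have "f = (\<lambda>p. if p \<in> sites G t then ?g p else None)"
  proof
    fix p show "f p = (if p \<in> sites G t then ?g p else None)"
      using R by (cases "f p") auto
  qed
  moreover have "?g \<in> (\<Pi>\<^sub>E p\<in>sites G t. insert None (Some ` (\<Union>u\<in>adj G (t, p). derivs_upto G n u)))"
  proof (rule restrict_PiE_iff[THEN iffD2], rule ballI)
    fix p show "f p \<in> insert None (Some ` (\<Union>u\<in>adj G (t, p). derivs_upto G n u))"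
      using R by (cases "f p") auto
  qed
  ultimately show ?L
    unfolding derivs_upto.simps using R by (intro image_eqI[where x = ?g]) auto
qed

declare derivs_upto.simps(2) [simp del]

lemma deriv_root_derivs_upto: "d \<in> derivs_upto G n t \<Longrightarrow> deriv_root d = t"
  by (cases n; cases d) (auto simp: mem_derivs_upto_Suc)

lemma derivs_upto_mono_Suc: "derivs_upto G n t \<subseteq> derivs_upto G (Suc n) t"
proof (induction n arbitrary: t)
  case (Suc n)
  show ?case
  proof
    fix d assume d: "d \<in> derivs_upto G (Suc n) t"
    show "d \<in> derivs_upto G (Suc (Suc n)) t"
    proof (cases d)
      case (Deriv t' f)
      with d Suc.IH show ?thesis unfolding Deriv mem_derivs_upto_Suc by blast
    qed
  qed
qed simp

lemma derivs_upto_mono: "m \<le> n \<Longrightarrow> derivs_upto G m t \<subseteq> derivs_upto G n t"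
  by (rule lift_Suc_mono_le[of "\<lambda>n. derivs_upto G n t"]) (rule derivs_upto_mono_Suc)

text \<open>A tree has finitely many sites, so the depths of the immediate subderivations have a
  common bound.\<close>

lemma valid_deriv_imp_derivs_upto:
  assumes "valid_deriv G d"
  shows "\<exists>n. d \<in> derivs_upto G n (deriv_root d)"
  using assms
proof induction
  case (1 t f)
  have "\<forall>p. \<exists>n. \<forall>d. f p = Some d \<longrightarrow> d \<in> derivs_upto G n (deriv_root d)"
  proof
    fix p show "\<exists>n. \<forall>d. f p = Some d \<longrightarrow> d \<in> derivs_upto G n (deriv_root d)"
      using 1 by (cases "f p") auto
  qed
  then obtain N where N: "\<And>p d. f p = Some d \<Longrightarrow> d \<in> derivs_upto G (N p) (deriv_root d)"
    by metis
  \<comment> \<open>Without sites this \<open>Max\<close> is unspecified, but then f is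
    \<open>None\<close> everywhere and the claim below is vacuous.\<close>
  define n where "n = Max (N ` sites G t)"
  have "p \<in> sites G t \<and> (\<exists>u\<in>adj G (t, p). d \<in> derivs_upto G n u)" if "f p = Some d" for p d
  proof -
    have p: "p \<in> sites G t" "deriv_root d \<in> adj G (t, p)"
      using 1(2) that by auto
    then have "N p \<le> n"
      using finite_sites[of G t] by (auto simp: n_def)
    then show ?thesis
      using p N[OF that] derivs_upto_mono[of "N p" n G "deriv_root d"] by auto
  qed
  then have "Deriv t f \<in> derivs_upto G (Suc n) t"
    by (simp add: mem_derivs_upto_Suc)
  then show ?case by (metis deriv.sel)
qed

section \<open>The probability of derivations of bounded depth\<close>

text \<open>Used to group derivations by their yields: A is in bijection with the disjoint union of
  the fibres of g, over which a summable family may be summed iteratively.\<close>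

lemma infsum_fibers:
  fixes f :: "'a \<Rightarrow> 'b::banach"
  assumes "f summable_on A"
  shows "(\<Sum>\<^sub>\<infinity>v \<in> g ` A. \<Sum>\<^sub>\<infinity>a \<in> {a \<in> A. g a = v}. f a) = infsum f A"
proof -
  let ?S = "SIGMA v:g ` A. {a \<in> A. g a = v}"
  have bij: "bij_betw (\<lambda>a. (g a, a)) A ?S"
    by (rule bij_betwI[where g = snd]) auto
  have "(\<lambda>(v, a). f a) summable_on ?S"
    using assms summable_on_reindex_bij_betw[OF bij, of "\<lambda>(v, a). f a"] by simp
  then show ?thesis
    using infsum_reindex_bij_betw[OF bij, of "\<lambda>(v, a). f a"] by (simp add: infsum_Sigma'_banach)
qed

section \<open>Adjunction probabilities at a node, and validity of derivations of bounded
  depth\<close>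

locale proper_ptag =
  fixes G :: "('n, 's) ptag"
  assumes is_ptag: "is_ptag G" and proper: "proper G"
begin

lemma finite_elementary: "finite (elementary G)"
  using is_ptag by (auto simp: is_ptag_def elementary_def)

lemma adj_subset_auxiliaries: "X \<in> adj_nodes G \<Longrightarrow> adj G X \<subseteq> auxiliaries G"
proof (cases X)
  case (Pair t p)
  assume "X \<in> adj_nodes G"
  then obtain u where "t \<in> elementary G" "subtree t p = Some u"
    by (auto simp: Pair adj_nodes_def addresses_def)
  then have "adj G (t, p) \<subseteq> {t' \<in> auxiliaries G. root_nt t' = root_nt u}"
    using is_ptag unfolding is_ptag_def by blast
  then show ?thesis using Pair by blast
qed

lemma adj_subset_elementary: "X \<in> adj_nodes G \<Longrightarrow> adj G X \<subseteq> elementary G"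
  unfolding elementary_def using adj_subset_auxiliaries by blast

lemma finite_adj: "X \<in> adj_nodes G \<Longrightarrow> finite (adj G X)"
  using adj_subset_elementary finite_elementary by (rule finite_subset)

lemma phi_nil_nonneg: "X \<in> adj_nodes G \<Longrightarrow> 0 \<le> phi G X None"
  using is_ptag by (auto simp: is_ptag_def)

lemma phi_nonadj_eq_0: "X \<in> adj_nodes G \<Longrightarrow> t \<in> elementary G - adj G X \<Longrightarrow> phi G X (Some t) = 0"
  using is_ptag unfolding is_ptag_def by blast

lemma phi_nonneg:
  assumes "X \<in> adj_nodes G" "t \<in> elementary G"
  shows "0 \<le> phi G X (Some t)"
proof (cases "t \<in> adj G X")
  case True
  then have "phi G X (Some t) \<in> {0..1}"
    using is_ptag assms unfolding is_ptag_def by blast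
  then show ?thesis by simp
qed (use phi_nonadj_eq_0 assms in auto)

text \<open>Derivations choose from Adj(X), whereas the matrix \<open>P_mat\<close> has a column for
  every elementary tree; the zero values of \<open>phi\<close> outside Adj(X) bridge the
  two.\<close>

lemma sum_adj_eq_sum_elementary:
  assumes "X \<in> adj_nodes G"
  shows "(\<Sum>t\<in>adj G X. phi G X (Some t) * h t) = (\<Sum>t\<in>elementary G. phi G X (Some t) * h t)"
  using assms phi_nonadj_eq_0
  by (intro sum.mono_neutral_left finite_elementary adj_subset_elementary) auto

lemma phi_nil_plus_sum_elementary:
  assumes X: "X \<in> adj_nodes G"
  shows "phi G X None + (\<Sum>t\<in>elementary G. phi G X (Some t)) = 1"
proof -
  have "(\<Sum>t\<in>elementary G. phi G X (Some t)) = (\<Sum>t\<in>auxiliaries G. phi G X (Some t))"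
    using adj_subset_auxiliaries[OF X] phi_nonadj_eq_0[OF X]
    by (intro sum.mono_neutral_right finite_elementary) (auto simp: elementary_def)
  then show ?thesis using proper X by (simp add: proper_def)
qed

lemma finite_derivs_upto: "t \<in> elementary G \<Longrightarrow> finite (derivs_upto G n t)"
proof (induction n arbitrary: t)
  case (Suc n)
  have "finite (\<Union>u\<in>adj G (t, p). derivs_upto G n u)" if "p \<in> sites G t" for p
  proof -
    have X: "(t, p) \<in> adj_nodes G" using that by (simp add: sites_def)
    show ?thesis
      using adj_subset_elementary[OF X] Suc.IH by (intro finite_UN_I finite_adj[OF X]) blast
  qed
  then show ?case
    by (simp add: derivs_upto.simps finite_PiE finite_sites)
qed simp

lemma valid_deriv_derivs_upto:
  "t \<in> elementary G \<Longrightarrow> d \<in> derivs_upto G n t \<Longrightarrow> valid_deriv G d"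
proof (induction n arbitrary: t d)
  case (Suc n)
  show ?case
  proof (cases d)
    case (Deriv t' f)
    with Suc.prems have t': "t' = t" and f: "\<And>p d. f p = Some d \<Longrightarrow>
        p \<in> sites G t \<and> (\<exists>u\<in>adj G (t, p). d \<in> derivs_upto G n u)"
      by (auto simp: mem_derivs_upto_Suc)
    show ?thesis unfolding Deriv t'
    proof (rule valid_deriv.intros[OF Suc.prems(1)])
      fix p d' assume "f p = Some d'"
      with f obtain u where p: "p \<in> sites G t" and u: "u \<in> adj G (t, p)" "d' \<in> derivs_upto G n u"
        by blast
      then have "u \<in> elementary G"
        using adj_subset_elementary by (auto simp: sites_def)
      then show "p \<in> sites G t \<and> deriv_root d' \<in> adj G (t, p) \<and> valid_deriv G d'"
        using p u Suc.IH deriv_root_derivs_upto by blast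
    qed
  qed
qed simp

lemma phi_product_nonneg: "valid_deriv G d \<Longrightarrow> 0 \<le> phi_product G d"
proof (induction rule: valid_deriv.induct)
  case (1 t f)
  show ?case unfolding phi_product_Deriv
  proof (rule prod_nonneg)
    fix p assume p: "p \<in> sites G t"
    then have X: "(t, p) \<in> adj_nodes G" by (simp add: sites_def)
    show "0 \<le> (case f p of None \<Rightarrow> phi G (t, p) None
        | Some d \<Rightarrow> phi G (t, p) (Some (deriv_root d)) * phi_product G d)"
    proof (cases "f p")
      case None
      then show ?thesis using phi_nil_nonneg[OF X] by simp
    next
      case (Some d)
      with 1(2) have d: "deriv_root d \<in> adj G (t, p)" "0 \<le> phi_product G d" by blast+
      then have "0 \<le> phi G (t, p) (Some (deriv_root d))"
        using phi_nonneg[OF X] adj_subset_elementary[OF X] by blast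
      then show ?thesis using Some d(2) by simp
    qed
  qed
qed

text \<open>The probability that the process started from t stops with at most n levels; the choice
  of the initial tree is not included.\<close>

definition mass_upto :: "nat \<Rightarrow> ('n, 's) tree \<Rightarrow> real" where
  "mass_upto n t = (\<Sum>d\<in>derivs_upto G n t. phi_product G d)"

text \<open>The probability that a tree is adjoined at \<open>X\<close> whose derivation has more than \<open>n\<close> levels.\<close>

definition defect :: "nat \<Rightarrow> ('n, 's) node \<Rightarrow> real" where
  "defect n X = (\<Sum>u\<in>elementary G. phi G X (Some u) * (1 - mass_upto n u))"

text \<open>The left side is the probability that the choice at X leads to at most n further levels;
  properness makes it the complement of the defect.\<close>

lemma phi_nil_plus_mass_eq_defect:
  assumes X: "X \<in> adj_nodes G"
  shows "phi G X None + (\<Sum>u\<in>adj G X. phi G X (Some u) * mass_upto n u) = 1 - defect n X"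
  using phi_nil_plus_sum_elementary[OF X]
  by (simp add: sum_adj_eq_sum_elementary[OF X] defect_def right_diff_distrib sum_subtractf)

text \<open>Independence of the sites: a derivation from t is a free choice of a continuation at
  each site, and the sum over all choice functions of a product factors into a product of
  sums.\<close>

lemma mass_upto_Suc:
  assumes t: "t \<in> elementary G"
  shows "mass_upto (Suc n) t = (\<Prod>p\<in>sites G t. 1 - defect n (t, p))"
proof -
  define C where "C p = (\<Union>u\<in>adj G (t, p). derivs_upto G n u)" for p
  define B where "B p = insert None (Some ` C p)" for p
  define w where "w p c = (case c of None \<Rightarrow> phi G (t, p) None
     | Some d \<Rightarrow> phi G (t, p) (Some (deriv_root d)) * phi_product G d)" for p c
  have X: "(t, p) \<in> adj_nodes G" if "p \<in> sites G t" for p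
    using that by (simp add: sites_def)
  have fin: "finite (derivs_upto G n u)" if "p \<in> sites G t" "u \<in> adj G (t, p)" for p u
    using that adj_subset_elementary[OF X] finite_derivs_upto by blast
  have finC: "finite (C p)" if "p \<in> sites G t" for p
    using that fin finite_adj[OF X] by (auto simp: C_def)
  \<comment> \<open>Both functions are \<open>undefined\<close> off the sites, so the derivation
    determines them.\<close>
  have inj: "inj_on (\<lambda>g. Deriv t (\<lambda>p. if p \<in> sites G t then g p else None)) (PiE (sites G t) B)"
  proof (rule inj_onI)
    fix g h assume gh: "g \<in> PiE (sites G t) B" "h \<in> PiE (sites G t) B"
      "Deriv t (\<lambda>p. if p \<in> sites G t then g p else None) =
       Deriv t (\<lambda>p. if p \<in> sites G t then h p else None)"
    then show "g = h"
      by (intro PiE_ext[OF gh(1,2)]) (auto simp: fun_eq_iff split: if_splits)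
  qed
  have "mass_upto (Suc n) t =
      (\<Sum>g\<in>PiE (sites G t) B. phi_product G (Deriv t (\<lambda>p. if p \<in> sites G t then g p else None)))"
    unfolding mass_upto_def derivs_upto.simps C_def[symmetric] B_def[symmetric] sum.reindex[OF inj]
    by (simp add: o_def)
  also have "\<dots> = (\<Sum>g\<in>PiE (sites G t) B. \<Prod>p\<in>sites G t. w p (g p))"
    unfolding phi_product_Deriv by (intro sum.cong prod.cong) (auto simp: w_def)
  also have "\<dots> = (\<Prod>p\<in>sites G t. \<Sum>c\<in>B p. w p c)"
    using finC by (intro prod_sum_PiE[symmetric] finite_sites) (auto simp: B_def)
  also have "\<dots> = (\<Prod>p\<in>sites G t. 1 - defect n (t, p))"
  proof (rule prod.cong)
    fix p assume p: "p \<in> sites G t"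
    have "(\<Sum>c\<in>B p. w p c) = phi G (t, p) None + (\<Sum>d\<in>C p. w p (Some d))"
      using finC[OF p] by (auto simp: B_def sum.reindex w_def)
    \<comment> \<open>The root of a derivation tells which tree was adjoined, so the union over
      Adj(t, p) is disjoint.\<close>
    also have "(\<Sum>d\<in>C p. w p (Some d)) = (\<Sum>u\<in>adj G (t, p). \<Sum>d\<in>derivs_upto G n u. w p (Some d))"
      unfolding C_def using finite_adj[OF X[OF p]] fin[OF p]
      by (intro sum.UNION_disjoint) (auto dest: deriv_root_derivs_upto)
    also have "\<dots> = (\<Sum>u\<in>adj G (t, p). phi G (t, p) (Some u) * mass_upto n u)"
      unfolding mass_upto_def sum_distrib_left
      by (intro sum.cong) (auto simp: w_def deriv_root_derivs_upto)
    finally show "(\<Sum>c\<in>B p. w p c) = 1 - defect n (t, p)"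
      using phi_nil_plus_mass_eq_defect[OF X[OF p]] by simp
  qed simp
  finally show ?thesis .
qed

lemma mass_upto_nonneg: "t \<in> elementary G \<Longrightarrow> 0 \<le> mass_upto n t"
  unfolding mass_upto_def by (intro sum_nonneg phi_product_nonneg valid_deriv_derivs_upto)

lemma defect_le_1:
  assumes X: "X \<in> adj_nodes G"
  shows "defect n X \<le> 1"
proof -
  have "0 \<le> phi G X None + (\<Sum>u\<in>adj G X. phi G X (Some u) * mass_upto n u)"
    using adj_subset_elementary[OF X]
    by (intro add_nonneg_nonneg sum_nonneg mult_nonneg_nonneg phi_nil_nonneg phi_nonneg X mass_upto_nonneg) auto
  then show ?thesis using phi_nil_plus_mass_eq_defect[OF X] by simp
qed

text \<open>The bound on the mass is a premise to avoid circularity: the induction for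
  \<open>mass_upto_le_1\<close> needs this fact at n to reach Suc n.\<close>

lemma defect_nonneg_if:
  assumes "X \<in> adj_nodes G" "\<And>t. t \<in> elementary G \<Longrightarrow> mass_upto n t \<le> 1"
  shows "0 \<le> defect n X"
  unfolding defect_def using assms by (intro sum_nonneg mult_nonneg_nonneg phi_nonneg) auto

lemma mass_upto_le_1: "t \<in> elementary G \<Longrightarrow> mass_upto n t \<le> 1"
proof (induction n arbitrary: t)
  case 0
  then show ?case by (simp add: mass_upto_def)
next
  case (Suc n)
  have "0 \<le> defect n (t, p)" "defect n (t, p) \<le> 1" if "p \<in> sites G t" for p
    using that Suc.IH defect_nonneg_if defect_le_1 by (auto simp: sites_def)
  then show ?case
    unfolding mass_upto_Suc[OF Suc.prems] by (intro prod_le_1) auto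
qed

lemma defect_nonneg: "X \<in> adj_nodes G \<Longrightarrow> 0 \<le> defect n X"
  using defect_nonneg_if mass_upto_le_1 by blast

text \<open>The union bound over the sites of t, obtained from the product formula since all defects
  lie between 0 and 1.\<close>

lemma mass_upto_Suc_ge:
  assumes "t \<in> elementary G"
  shows "1 - (\<Sum>p\<in>sites G t. defect n (t, p)) \<le> mass_upto (Suc n) t"
  unfolding mass_upto_Suc[OF assms]
  by (rule Weierstrass_prod_ineq) (auto simp: sites_def defect_nonneg defect_le_1)

lemma defect_Suc_le:
  assumes X: "X \<in> adj_nodes G"
  shows "defect (Suc n) X \<le> (\<Sum>Y\<in>adj_nodes G. phi G X (Some (fst Y)) * defect n Y)"
proof -
  have "defect (Suc n) X \<le>
      (\<Sum>u\<in>elementary G. phi G X (Some u) * (\<Sum>p\<in>sites G u. defect n (u, p)))"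
    unfolding defect_def[of "Suc n"]
    by (intro sum_mono mult_left_mono phi_nonneg X) (use mass_upto_Suc_ge in \<open>auto simp: algebra_simps\<close>)
  \<comment> \<open>Pairs of a tree u and a site of u are exactly the nodes Y in V with
    \<open>fst Y\<close> equal to u. The coefficient of Y is thus the entry of the expectation
    matrix in row X and column Y.\<close>
  also have "\<dots> = (\<Sum>Y\<in>adj_nodes G. phi G X (Some (fst Y)) * defect n Y)"
    unfolding adj_nodes_eq_Sigma sum_distrib_left
    by (subst sum.Sigma) (auto simp: finite_elementary finite_sites intro!: sum.cong)
  finally show ?thesis .
qed

lemma mass_upto_mono:
  assumes "t \<in> elementary G" "m \<le> n"
  shows "mass_upto m t \<le> mass_upto n t"
  unfolding mass_upto_def
  using assms by (intro sum_mono2 finite_derivs_upto derivs_upto_mono)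
    (auto intro: phi_product_nonneg valid_deriv_derivs_upto)

lemma decseq_defect: "X \<in> adj_nodes G \<Longrightarrow> decseq (\<lambda>n. defect n X)"
  unfolding decseq_def defect_def
  by (intro allI impI sum_mono mult_left_mono phi_nonneg) (auto intro: mass_upto_mono)

lemma mass_upto_tendsto_1:
  assumes t: "t \<in> elementary G"
    and defect: "\<And>X. X \<in> adj_nodes G \<Longrightarrow> (\<lambda>n. defect n X) \<longlonglongrightarrow> 0"
  shows "(\<lambda>n. mass_upto n t) \<longlonglongrightarrow> 1"
proof -
  have "(\<lambda>n. 1 - (\<Sum>p\<in>sites G t. defect n (t, p))) \<longlonglongrightarrow> 1 - (\<Sum>p\<in>sites G t. 0)"
    by (intro tendsto_intros defect) (simp add: sites_def)
  then have lower: "(\<lambda>n. 1 - (\<Sum>p\<in>sites G t. defect n (t, p))) \<longlonglongrightarrow> 1" by simp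
  have "(\<lambda>n. mass_upto (Suc n) t) \<longlonglongrightarrow> 1"
    by (rule real_tendsto_sandwich[OF _ _ lower tendsto_const])
      (use mass_upto_Suc_ge[OF t] mass_upto_le_1[OF t] in auto)
  then show ?thesis by (rule LIMSEQ_imp_Suc)
qed

section \<open>The total probability of complete derivations\<close>

lemma start_initials_subset: "start_initials G \<subseteq> elementary G"
  by (auto simp: start_initials_def elementary_def)

lemma finite_start_initials: "finite (start_initials G)"
  using start_initials_subset finite_elementary by (rule finite_subset)

lemma sum_deriv_prob_derivs_upto:
  "(\<Sum>d\<in>(\<Union>t\<in>start_initials G. derivs_upto G n t). deriv_prob G d) =
   (\<Sum>t\<in>start_initials G. init G t * mass_upto n t)"
proof -
  have "(\<Sum>d\<in>(\<Union>t\<in>start_initials G. derivs_upto G n t). deriv_prob G d) =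
      (\<Sum>t\<in>start_initials G. \<Sum>d\<in>derivs_upto G n t. deriv_prob G d)"
    using start_initials_subset finite_derivs_upto
    by (intro sum.UNION_disjoint finite_start_initials) (auto dest: deriv_root_derivs_upto)
  also have "\<dots> = (\<Sum>t\<in>start_initials G. init G t * mass_upto n t)"
    unfolding mass_upto_def sum_distrib_left
    by (intro sum.cong) (auto simp: deriv_prob_def deriv_root_derivs_upto)
  finally show ?thesis .
qed

lemma derivs_upto_subset_complete_derivs:
  "(\<Union>t\<in>start_initials G. derivs_upto G n t) \<subseteq> complete_derivs G"
  using start_initials_subset valid_deriv_derivs_upto
  unfolding complete_derivs_def by (auto dest: deriv_root_derivs_upto)

text \<open>Each complete derivation has finite depth and the depth-bounded sets increase, so finite
  partial sums can be compared with depth-bounded ones.\<close>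

lemma finite_subset_complete_derivs:
  assumes "finite F" "F \<subseteq> complete_derivs G"
  shows "\<exists>n. F \<subseteq> (\<Union>t\<in>start_initials G. derivs_upto G n t)"
  using assms
proof (induction F)
  case (insert d F)
  then obtain n where n: "F \<subseteq> (\<Union>t\<in>start_initials G. derivs_upto G n t)" by auto
  from insert.prems obtain m where m: "d \<in> derivs_upto G m (deriv_root d)" "deriv_root d \<in> start_initials G"
    using valid_deriv_imp_derivs_upto[of G d] by (auto simp: complete_derivs_def)
  let ?C = "\<lambda>k. \<Union>t\<in>start_initials G. derivs_upto G k t"
  have mono: "?C k \<subseteq> ?C (max m n)" if "k \<le> max m n" for k
    using derivs_upto_mono[OF that] by (rule UN_mono[OF subset_refl])
  have "d \<in> ?C m" using m by (intro UN_I)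
  then have "d \<in> ?C (max m n)" using mono[of m] by (rule subsetD[rotated]) simp
  moreover have "F \<subseteq> ?C (max m n)" using n mono[of n] by (rule subset_trans) simp
  ultimately show ?case by (intro exI[of _ "max m n"] insert_subsetI)
qed simp

text \<open>Finite partial sums are at most 1 because they sit inside a depth-bounded sum;
  conversely the depth-bounded sums tend to 1, which forces the total to be at least 1.\<close>

lemma has_sum_complete_derivs:
  assumes start: "start_ok G"
    and mass: "\<And>t. t \<in> elementary G \<Longrightarrow> (\<lambda>n. mass_upto n t) \<longlonglongrightarrow> 1"
  shows "(deriv_prob G has_sum 1) (complete_derivs G)"
proof -
  let ?C = "\<lambda>n. \<Union>t\<in>start_initials G. derivs_upto G n t"
  have init: "\<And>t. t \<in> start_initials G \<Longrightarrow> 0 \<le> init G t" "(\<Sum>t\<in>start_initials G. init G t) = 1"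
    using start by (auto simp: start_ok_def)
  have nonneg: "0 \<le> deriv_prob G d" if "d \<in> complete_derivs G" for d
    using that init phi_product_nonneg by (auto simp: complete_derivs_def deriv_prob_def)
  have finC: "finite (?C n)" for n
    using finite_start_initials start_initials_subset finite_derivs_upto by blast
  have bound: "sum (deriv_prob G) F \<le> 1" if F: "finite F" "F \<subseteq> complete_derivs G" for F
  proof -
    obtain n where n: "F \<subseteq> ?C n" using finite_subset_complete_derivs[OF F] by blast
    have "sum (deriv_prob G) F \<le> sum (deriv_prob G) (?C n)"
      using n finC nonneg derivs_upto_subset_complete_derivs[of n] by (intro sum_mono2) auto
    also have "\<dots> \<le> (\<Sum>t\<in>start_initials G. init G t * 1)"
      unfolding sum_deriv_prob_derivs_upto
      using init(1) mass_upto_le_1 start_initials_subset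
      by (intro sum_mono mult_left_mono) auto
    finally show ?thesis using init(2) by simp
  qed
  \<comment> \<open>Establishes that the infinite sum is a genuine one and not the default value
    0.\<close>
  have summable: "deriv_prob G summable_on complete_derivs G"
    by (rule nonneg_bdd_above_summable_on[OF nonneg]) (auto intro!: bdd_aboveI2 bound)
  have "(\<lambda>n. \<Sum>t\<in>start_initials G. init G t * mass_upto n t) \<longlonglongrightarrow> (\<Sum>t\<in>start_initials G. init G t * 1)"
    using start_initials_subset by (intro tendsto_intros mass) auto
  then have "(\<lambda>n. sum (deriv_prob G) (?C n)) \<longlonglongrightarrow> 1"
    using init(2) by (simp add: sum_deriv_prob_derivs_upto)
  moreover have "sum (deriv_prob G) (?C n) \<le> infsum (deriv_prob G) (complete_derivs G)" for n
    using summable finC derivs_upto_subset_complete_derivs nonneg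
    by (intro finite_sum_le_infsum) auto
  ultimately have "1 \<le> infsum (deriv_prob G) (complete_derivs G)"
    by (intro LIMSEQ_le_const2) auto
  moreover have "infsum (deriv_prob G) (complete_derivs G) \<le> 1"
    using summable bound by (rule infsum_le_finite_sums)
  ultimately show ?thesis
    using has_sum_infsum[OF summable] by simp
qed

lemma consistent_if_defect_tendsto_0:
  assumes start: "start_ok G"
    and defect: "\<And>X. X \<in> adj_nodes G \<Longrightarrow> (\<lambda>n. defect n X) \<longlonglongrightarrow> 0"
  shows "consistent G"
proof -
  have "(deriv_prob G has_sum 1) (complete_derivs G)"
    using start mass_upto_tendsto_1[OF _ defect] by (rule has_sum_complete_derivs)
  then show ?thesis
    using infsum_fibers[of "deriv_prob G" "complete_derivs G" "deriv_yield G"]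
    by (auto simp: consistent_def lang_def string_prob_def simp: has_sum_imp_summable infsumI)
qed

end

section \<open>Correctness of the procedure\<close>

lemma expectation_mat_carrier:
  "expectation_mat G Xs ts \<in> carrier_mat (length Xs) (length Xs)"
  unfolding expectation_mat_def P_mat_def N_mat_def
  by (rule mult_carrier_mat[OF mat_carrier mat_carrier])

text \<open>A node belongs to a single elementary tree, which occurs once in ts, so one summand of
  the matrix product survives.\<close>

lemma expectation_mat_entry:
  assumes "distinct ts" "fst (Xs ! j) \<in> set ts" "i < length Xs" "j < length Xs"
  shows "expectation_mat G Xs ts $$ (i, j) = phi G (Xs ! i) (Some (fst (Xs ! j)))"
proof -
  obtain k where k: "k < length ts" "ts ! k = fst (Xs ! j)"
    using assms(2) by (auto simp: in_set_conv_nth)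
  have "expectation_mat G Xs ts $$ (i, j) =
      (\<Sum>l<length ts. phi G (Xs ! i) (Some (ts ! l)) * (if fst (Xs ! j) = ts ! l then 1 else 0))"
    using assms(3,4)
    by (simp add: expectation_mat_def P_mat_def N_mat_def scalar_prod_def lessThan_atLeast0)
  also have "\<dots> = (\<Sum>l<length ts. if l = k then phi G (Xs ! i) (Some (fst (Xs ! j))) else 0)"
    using k assms(1) by (intro sum.cong) (auto simp: nth_eq_iff_index_eq)
  also have "\<dots> = phi G (Xs ! i) (Some (fst (Xs ! j)))"
    using k(1) by simp
  finally show ?thesis .
qed

theorem mainTheorem2:
  fixes G :: "('n, 's) ptag"
    and Xs :: "('n, 's) node list"
    and ts :: "('n, 's) tree list"
  assumes "is_ptag G"
    and "lexicalized G"
    and "proper G"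
    and "no_foot_adjunction G"
    and "start_ok G"
    and "distinct Xs" and "set Xs = adj_nodes G"
    and "distinct ts" and "set ts = elementary G"
  shows "(rho (expectation_mat G Xs ts) < 1 \<longrightarrow> halts (expectation_mat G Xs ts)) \<and>
         (rho (expectation_mat G Xs ts) \<ge> 1 \<longrightarrow> \<not> halts (expectation_mat G Xs ts)) \<and>
         (halts (expectation_mat G Xs ts) \<longrightarrow> consistent G)"
proof -
  interpret proper_ptag G
    by unfold_locales (fact assms)+
  let ?M = "expectation_mat G Xs ts" and ?k = "length Xs"
  note M = expectation_mat_carrier[of G Xs ts]
  have node: "Xs ! i \<in> adj_nodes G" "fst (Xs ! i) \<in> elementary G" if "i < ?k" for i
    using that assms(7) nth_mem[OF that] by (auto simp: adj_nodes_def)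
  have entry: "?M $$ (i, j) = phi G (Xs ! i) (Some (fst (Xs ! j)))" if "i < ?k" "j < ?k" for i j
    using that node assms(8,9) by (intro expectation_mat_entry) auto
  have nonneg: "0 \<le> ?M $$ (i, j)" if "i < ?k" "j < ?k" for i j
    using that by (simp add: entry phi_nonneg node)
  have step: "defect (Suc n) (Xs ! i) \<le> (\<Sum>j<?k. ?M $$ (i, j) * defect n (Xs ! j))"
    if "i < ?k" for n i
  proof -
    have "(\<Sum>j<?k. ?M $$ (i, j) * defect n (Xs ! j)) =
        (\<Sum>j<?k. phi G (Xs ! i) (Some (fst (Xs ! j))) * defect n (Xs ! j))"
      using that by (intro sum.cong) (auto simp: entry)
    also have "\<dots> = (\<Sum>Y\<in>adj_nodes G. phi G (Xs ! i) (Some (fst Y)) * defect n Y)"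
      \<comment> \<open>Distinctness of Xs makes indexing a bijection onto V.\<close>
      by (intro sum.reindex_bij_betw bij_betw_nth) (auto simp: assms)
    finally show ?thesis using defect_Suc_le[OF node(1)[OF that]] by simp
  qed
  have "consistent G" if "halts ?M"
  proof (rule consistent_if_defect_tendsto_0[OF \<open>start_ok G\<close>])
    from that obtain a where rs: "row_sums_less_one (?M ^\<^sub>m (2 ^ a))"
      by (auto simp: halts_iff)
    fix X assume "X \<in> adj_nodes G"
    then obtain i where i: "i < ?k" "X = Xs ! i"
      using assms(7) by (metis in_set_conv_nth)
    \<comment> \<open>The defects at the enumerated nodes are the iterates: \<open>step\<close> is
      the one-step bound, and the power at which the procedure halted supplies the
      contraction.\<close>
    show "(\<lambda>n. defect n X) \<longlonglongrightarrow> 0"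
      unfolding i(2)
      by (rule iterates_tendsto_zero[OF M nonneg rs, where x = "\<lambda>n i. defect n (Xs ! i)"])
        (use i step in \<open>auto intro: defect_nonneg defect_le_1 decseq_defect node\<close>)
  qed
  \<comment> \<open>The direction from halting to the spectral radius, read contrapositively, gives
    the non-halting claim.\<close>
  moreover have "rho ?M < 1 \<longleftrightarrow> halts ?M"
    using halts_if_rho_less_one[OF M] rho_less_one_if_halts[OF M nonneg] by blast
  ultimately show ?thesis by auto
qed

end
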